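(* Let $p(z)=\sum_{j=0}^{n}a_jz^j$, with $a_0\neq 0$, be a polynomial of degree $n$ with complex coefficients, and write $\alpha_j=\operatorname{Re}(a_j)$ and $\beta_j=\operatorname{Im}(a_j)$ for $0\le j\le n$. Suppose that $$\alpha_{n}\geq\alpha_{n-1}\geq\alpha_{n-2}\geq\cdots\geq\alpha_{1}\geq\alpha_{0}.$$ Then for every $\delta$ with $0<\delta<1$, the number of zeros of $p$ in the disk $|z|\leq\delta$ does not exceed $$\frac{1}{\log (1/\delta)}\log\frac{M_1}{|a_0|},$$ where $$M_1=|\alpha_0|-\alpha_0+|\alpha_n|+\alpha_n+2\sum_{j=0}^{n}|\beta_j|.$$
   Context: Zeros are counted with multiplicity. *)

theory Defs
  imports Complex_Main "HOL-Computational_Algebra.Polynomial"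
begin

end

theory Submission
  imports Defs
    "HOL-Complex_Analysis.Conformal_Mappings"
    "HOL-Computational_Algebra.Fundamental_Theorem_Algebra"
begin

text \<open>
  The polynomial \<open>F(z) = (1 - z) p(z)\<close> has the same zeros as \<open>p\<close> in the open unit disk,
  with the same multiplicities, and the same value at \<open>0\<close>. Its coefficients are the differences
  \<open>a\<^sub>j - a\<^sub>j\<^sub>-\<^sub>1\<close> together with the end terms \<open>a\<^sub>0\<close> and \<open>-a\<^sub>n\<close>. As the real parts increase,
  the real parts of the differences telescope, and on the closed unit disk the triangle
  inequality yields \<open>|F| \<le> M\<^sub>1\<close> (\<open>norm_one_minus_mult_poly_le\<close>).

  A polynomial bounded by \<open>M\<close> on the unit circle that has \<open>N\<close> zeros of modulus at most \<open>\<delta> < 1\<close>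
  has modulus at most \<open>\<delta>\<^sup>N M\<close> at the origin; this is the form of Jensen's inequality that
  is needed (\<open>norm_poly_0_le_power_zeros\<close>). Replacing a factor \<open>w - z\<close> by \<open>1 - cnj z w\<close>, which
  for \<open>z \<noteq> 0\<close> reflects the zero in the unit circle, leaves the modulus on the circle unchanged; at
  the origin it turns a factor of modulus at most \<open>\<delta>\<close> into the factor \<open>1\<close>. The maximum modulus
  principle bounds the new polynomial at the origin by \<open>M\<close>, and each of the \<open>N\<close> factors
  contributes a power of \<open>\<delta>\<close>. With \<open>M = M\<^sub>1\<close> and \<open>|F(0)| = |a\<^sub>0|\<close>, taking logarithms finishes the proof.
\<close>

text \<open>
  Blaschke factors are unimodular on the circle: there \<open>w cnj w = 1\<close>, so the left expression is
  \<open>w\<close> times the conjugate of \<open>w - z\<close>.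
\<close>
lemma norm_reflected_linear_factor:
  fixes w z :: complex
  assumes "cmod w = 1"
  shows "cmod (1 - cnj z * w) = cmod (w - z)"
proof -
  have "w * cnj w = 1"
    using assms by (simp add: complex_norm_square [symmetric])
  then have "1 - cnj z * w = w * cnj (w - z)"
    by (simp add: algebra_simps)
  then show ?thesis
    using assms by (simp only: norm_mult complex_mod_cnj mult_1)
qed

lemma norm_poly_0_le_of_unit_circle:
  fixes P :: "complex poly"
  assumes "\<And>w. cmod w = 1 \<Longrightarrow> cmod (poly P w) \<le> M"
  shows "cmod (poly P 0) \<le> M"
proof (rule maximum_modulus_frontier [of "poly P" "cball 0 1"])
  show "poly P holomorphic_on interior (cball 0 1)"
    by (intro holomorphic_intros)
  show "continuous_on (closure (cball 0 1)) (poly P)"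
    by (intro continuous_intros)
qed (use assms in \<open>auto simp: sphere_def\<close>)

text \<open>
  The zeros in the small disk are split off as a factor; replacing each \<open>w - z\<close> in it by
  \<open>1 - cnj z w\<close> gives the reflected polynomial, to which the maximum modulus principle applies.
\<close>
lemma norm_poly_0_le_power_zeros:
  fixes P :: "complex poly"
  assumes "P \<noteq> 0"
    and bound: "\<And>w. cmod w = 1 \<Longrightarrow> cmod (poly P w) \<le> M"
  shows "cmod (poly P 0) \<le> \<delta> ^ (\<Sum>z | poly P z = 0 \<and> cmod z \<le> \<delta>. order z P) * M"
proof -
  define Z where "Z = {z. poly P z = 0 \<and> cmod z \<le> \<delta>}"
  define Q where "Q = smult (lead_coeff P) (\<Prod>z\<in>{z. poly P z = 0} - Z. [:-z, 1:] ^ order z P)"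
  define H where "H = (\<Prod>z\<in>Z. [:1, -cnj z:] ^ order z P) * Q"
  have fin: "finite {z. poly P z = 0}"
    using \<open>P \<noteq> 0\<close> by (rule poly_roots_finite)
  have "(\<Prod>z | poly P z = 0. [:-z, 1:] ^ order z P) =
      (\<Prod>z\<in>{z. poly P z = 0} - Z. [:-z, 1:] ^ order z P) * (\<Prod>z\<in>Z. [:-z, 1:] ^ order z P)"
    by (rule prod.subset_diff) (use fin in \<open>auto simp: Z_def\<close>)
  then have P: "P = (\<Prod>z\<in>Z. [:-z, 1:] ^ order z P) * Q"
    using complex_poly_decompose [of P] by (simp add: Q_def mult.commute)
  have P_at: "cmod (poly P w) = (\<Prod>z\<in>Z. cmod (w - z) ^ order z P) * cmod (poly Q w)" for w
    by (subst P) (simp add: poly_prod norm_mult norm_power flip: prod_norm)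
  have H_at: "cmod (poly H w) = (\<Prod>z\<in>Z. cmod (1 - cnj z * w) ^ order z P) * cmod (poly Q w)" for w
    by (simp add: H_def poly_prod norm_mult norm_power mult.commute flip: prod_norm)
  have "cmod (poly H w) \<le> M" if "cmod w = 1" for w
    using bound [OF that] by (simp add: P_at H_at norm_reflected_linear_factor that)
  then have "cmod (poly H 0) \<le> M"
    by (rule norm_poly_0_le_of_unit_circle)
  then have Q0: "cmod (poly Q 0) \<le> M"
    by (simp add: H_at)
  have "(\<Prod>z\<in>Z. cmod z ^ order z P) \<le> (\<Prod>z\<in>Z. \<delta> ^ order z P)"
    by (intro prod_mono) (auto simp: Z_def intro: power_mono)
  also have "\<dots> = \<delta> ^ (\<Sum>z\<in>Z. order z P)"
    by (simp add: power_sum)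
  finally have prod_le: "(\<Prod>z\<in>Z. cmod z ^ order z P) \<le> \<delta> ^ (\<Sum>z\<in>Z. order z P)" .
  have "cmod (poly P 0) = (\<Prod>z\<in>Z. cmod z ^ order z P) * cmod (poly Q 0)"
    by (simp add: P_at)
  also have "\<dots> \<le> \<delta> ^ (\<Sum>z\<in>Z. order z P) * M"
  proof (rule mult_mono [OF prod_le Q0])
    show "0 \<le> \<delta> ^ (\<Sum>z\<in>Z. order z P)"
      by (rule order_trans [OF _ prod_le]) (simp add: prod_nonneg)
  qed simp
  finally show ?thesis
    by (simp add: Z_def)
qed

lemma one_minus_mult_sum_powers:
  fixes a :: "nat \<Rightarrow> 'a :: comm_ring_1"
  shows "(1 - w) * (\<Sum>j\<le>n. a j * w ^ j) =
    a 0 + (\<Sum>j<n. (a (Suc j) - a j) * w ^ Suc j) - a n * w ^ Suc n"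
  by (induction n) (simp_all add: algebra_simps)

text \<open>
  Each coefficient of \<open>(1 - w) p\<close> is bounded by the moduli of its real and imaginary parts. The
  real parts of the differences are nonnegative by monotonicity and telescope to
  \<open>Re a\<^sub>n - Re a\<^sub>0\<close>; each imaginary part is counted twice.
\<close>
lemma norm_one_minus_mult_poly_le:
  fixes p :: "complex poly"
  assumes mono: "\<And>j. j < degree p \<Longrightarrow> Re (coeff p j) \<le> Re (coeff p (Suc j))"
    and w: "cmod w \<le> 1"
  shows "cmod ((1 - w) * poly p w) \<le>
    \<bar>Re (coeff p 0)\<bar> - Re (coeff p 0) + \<bar>Re (lead_coeff p)\<bar> + Re (lead_coeff p)
      + 2 * (\<Sum>j\<le>degree p. \<bar>Im (coeff p j)\<bar>)"
proof -
  define a where "a = coeff p"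
  define n where "n = degree p"
  have term_le: "cmod (c * w ^ k) \<le> \<bar>Re c\<bar> + \<bar>Im c\<bar>" for c k
  proof -
    have "cmod (c * w ^ k) \<le> cmod c"
      using w by (simp add: norm_mult norm_power mult_left_le power_le_one)
    also have "\<dots> \<le> \<bar>Re c\<bar> + \<bar>Im c\<bar>"
      by (rule cmod_le)
    finally show ?thesis .
  qed
  have diff_le: "cmod ((a (Suc j) - a j) * w ^ Suc j) \<le>
      (Re (a (Suc j)) - Re (a j)) + (\<bar>Im (a (Suc j))\<bar> + \<bar>Im (a j)\<bar>)" if "j < n" for j
    using term_le [of "a (Suc j) - a j" "Suc j"] mono [of j] that
    by (simp add: a_def n_def)
  have "cmod (\<Sum>j<n. (a (Suc j) - a j) * w ^ Suc j) \<le>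
      (\<Sum>j<n. (Re (a (Suc j)) - Re (a j)) + (\<bar>Im (a (Suc j))\<bar> + \<bar>Im (a j)\<bar>))"
    by (rule sum_norm_le) (use diff_le in simp)
  also have "\<dots> = Re (a n) - Re (a 0) + (\<Sum>j<n. \<bar>Im (a (Suc j))\<bar>) + (\<Sum>j<n. \<bar>Im (a j)\<bar>)"
    by (simp add: sum.distrib sum_lessThan_telescope [of "\<lambda>j. Re (a j)"])
  finally have middle: "cmod (\<Sum>j<n. (a (Suc j) - a j) * w ^ Suc j) \<le>
      Re (a n) - Re (a 0) + (\<Sum>j<n. \<bar>Im (a (Suc j))\<bar>) + (\<Sum>j<n. \<bar>Im (a j)\<bar>)" .
  have "cmod ((1 - w) * poly p w) =
      cmod (a 0 + (\<Sum>j<n. (a (Suc j) - a j) * w ^ Suc j) - a n * w ^ Suc n)"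
    by (simp only: poly_altdef one_minus_mult_sum_powers a_def n_def)
  also have "\<dots> \<le> cmod (a 0) + cmod (\<Sum>j<n. (a (Suc j) - a j) * w ^ Suc j) + cmod (a n * w ^ Suc n)"
    by (rule order_trans [OF norm_triangle_ineq4 add_right_mono [OF norm_triangle_ineq]])
  also have "\<dots> \<le> (\<bar>Re (a 0)\<bar> + \<bar>Im (a 0)\<bar>)
      + (Re (a n) - Re (a 0) + (\<Sum>j<n. \<bar>Im (a (Suc j))\<bar>) + (\<Sum>j<n. \<bar>Im (a j)\<bar>))
      + (\<bar>Re (a n)\<bar> + \<bar>Im (a n)\<bar>)"
    by (intro add_mono cmod_le middle term_le)
  also have "\<dots> = \<bar>Re (a 0)\<bar> - Re (a 0) + \<bar>Re (a n)\<bar> + Re (a n)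
      + ((\<bar>Im (a 0)\<bar> + (\<Sum>j<n. \<bar>Im (a (Suc j))\<bar>)) + ((\<Sum>j<n. \<bar>Im (a j)\<bar>) + \<bar>Im (a n)\<bar>))"
    by simp
  also have "\<bar>Im (a 0)\<bar> + (\<Sum>j<n. \<bar>Im (a (Suc j))\<bar>) = (\<Sum>j\<le>n. \<bar>Im (a j)\<bar>)"
    by (rule sum.atMost_shift [symmetric])
  also have "(\<Sum>j<n. \<bar>Im (a j)\<bar>) + \<bar>Im (a n)\<bar> = (\<Sum>j\<le>n. \<bar>Im (a j)\<bar>)"
    by (simp flip: lessThan_Suc_atMost)
  finally show ?thesis
    by (simp add: a_def n_def)
qed

theorem corollary3:
  fixes p :: "complex poly" and n :: nat and \<alpha> \<beta> :: "nat \<Rightarrow> real" and M\<^sub>1 \<delta> :: real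
  assumes "degree p = n"
    and "coeff p 0 \<noteq> 0"
    and "\<And>j. j \<le> n \<Longrightarrow> \<alpha> j = Re (coeff p j)"
    and "\<And>j. j \<le> n \<Longrightarrow> \<beta> j = Im (coeff p j)"
    and "\<And>j. j < n \<Longrightarrow> \<alpha> j \<le> \<alpha> (Suc j)"
    and "M\<^sub>1 = \<bar>\<alpha> 0\<bar> - \<alpha> 0 + \<bar>\<alpha> n\<bar> + \<alpha> n + 2 * (\<Sum>j=0..n. \<bar>\<beta> j\<bar>)"
    and "0 < \<delta>" and "\<delta> < 1"
  shows "real (\<Sum>z | poly p z = 0 \<and> cmod z \<le> \<delta>. order z p)
           \<le> 1 / ln (1 / \<delta>) * ln (M\<^sub>1 / cmod (coeff p 0))"
proof -
  define F where "F = [:1, -1:] * p"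
  define N where "N = (\<Sum>z | poly p z = 0 \<and> cmod z \<le> \<delta>. order z p)"
  have "p \<noteq> 0"
    using assms(2) by auto
  then have "F \<noteq> 0"
    unfolding F_def by (subst mult_eq_0_iff) simp
  have F_eval: "poly F w = (1 - w) * poly p w" for w
    by (simp add: F_def algebra_simps)
  have M\<^sub>1: "M\<^sub>1 = \<bar>Re (coeff p 0)\<bar> - Re (coeff p 0) + \<bar>Re (lead_coeff p)\<bar> + Re (lead_coeff p)
      + 2 * (\<Sum>j\<le>degree p. \<bar>Im (coeff p j)\<bar>)"
    using assms(1,3,4,6) by (simp add: atMost_atLeast0)
  have F_le: "cmod (poly F w) \<le> M\<^sub>1" if "cmod w = 1" for w
    unfolding F_eval M\<^sub>1
    by (rule norm_one_minus_mult_poly_le) (use assms(1,3,5) that in force)+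
  \<comment> \<open>The additional zero of \<open>F\<close>, at \<open>1\<close>, is outside the disk because \<open>\<delta> < 1\<close>.\<close>
  have "order z F = order z p" if "cmod z \<le> \<delta>" for z
  proof -
    have "z \<noteq> 1"
      using that \<open>\<delta> < 1\<close> by auto
    then have "order z [:1, -1:] = 0"
      by (intro order_0I) simp
    then show ?thesis
      using order_mult [OF \<open>F \<noteq> 0\<close> [unfolded F_def], of z] by (simp only: F_def add_0)
  qed
  moreover have "{z. poly F z = 0 \<and> cmod z \<le> \<delta>} = {z. poly p z = 0 \<and> cmod z \<le> \<delta>}"
    using \<open>\<delta> < 1\<close> by (auto simp: F_eval)
  ultimately have "(\<Sum>z | poly F z = 0 \<and> cmod z \<le> \<delta>. order z F) = N"
    by (simp add: N_def)
  then have "cmod (poly F 0) \<le> \<delta> ^ N * M\<^sub>1"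
    using norm_poly_0_le_power_zeros [OF \<open>F \<noteq> 0\<close> F_le, of \<delta>] by simp
  then have jensen: "cmod (coeff p 0) \<le> \<delta> ^ N * M\<^sub>1"
    by (simp only: F_eval diff_zero mult_1 poly_0_coeff_0 [symmetric])
  have "0 < cmod (coeff p 0)"
    using assms(2) by simp
  have "(1 / \<delta>) ^ N \<le> M\<^sub>1 / cmod (coeff p 0)"
    using jensen \<open>0 < cmod (coeff p 0)\<close> \<open>0 < \<delta>\<close>
    by (simp add: power_divide field_simps)
  then have "ln ((1 / \<delta>) ^ N) \<le> ln (M\<^sub>1 / cmod (coeff p 0))"
    using \<open>0 < \<delta>\<close> by (intro ln_mono) auto
  then have "real N * ln (1 / \<delta>) \<le> ln (M\<^sub>1 / cmod (coeff p 0))"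
    using \<open>0 < \<delta>\<close> by (simp add: ln_realpow)
  moreover have "0 < ln (1 / \<delta>)"
    using \<open>0 < \<delta>\<close> \<open>\<delta> < 1\<close> by simp
  ultimately have "real N \<le> 1 / ln (1 / \<delta>) * ln (M\<^sub>1 / cmod (coeff p 0))"
    by (simp add: field_simps)
  then show ?thesis
    by (simp only: N_def)
qed

end
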